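(* A uniform association scheme is dismantlable. Any dismantled scheme of a uniform scheme is also uniform.
   Context: A symmetric $d$-class association scheme $(X,\mathcal R)$: partition $\{R_0,\dots,R_d\}$ of $X\times X$, $R_0$ diagonal, each $R_i$ symmetric, constant intersection numbers; $A_i$ adjacency matrices. An imprimitivity system: an index set $\mathcal I$ with $\{0\}\subsetneq\mathcal I\subsetneq\{0,\dots,d\}$ such that $\bigcup_{i\in\mathcal I}R_i$ is an equivalence relation whose classes (fibres) all have size $n$; $w$ fibres. For fibres $U,V$ let $\mathcal I(U,V)=\{i:R_i\cap(U\times V)\ne\emptyset\}$ and let $M^{UV}$ agree with $M$ on $U\times V$ and be zero elsewhere. Uniform: $\mathcal I(U,V)=\{0,\dots,d\}\setminus\mathcal I$ for all distinct fibres $U,V$, and there are integers $a^h_{ij}$ with $A_i^{UV}A_j^{VW}=\sum_ha^h_{ij}A_h^{UW}$ for all fibres $U,V,W$, $i\in\mathcal I(U,V)$, $j\in\mathcal I(V,W)$. Dismantlable: for every union $Y$ of fibres, the nonempty relations among $R_i\cap(Y\times Y)$ form an association scheme on $Y$; when $Y$ is a union of at least two fibres this is a dismantled scheme (with the induced imprimitivity system on $Y$). *)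

theory Defs
  imports Main "HOL-Library.Disjoint_Sets"
begin

text \<open>
  The relations of a scheme on \<open>X\<close> are \<open>R i\<close> for \<open>i\<close> in a finite set \<open>D\<close> of labels
  containing \<open>0\<close>; a \<open>d\<close>-class scheme in the usual labelling has \<open>D = {0..d}\<close>. General
  label sets are allowed so that the nonempty relations on a subset of \<open>X\<close> keep their
  labels. Values of \<open>R\<close> outside \<open>D\<close> are irrelevant. Since the parts of a partition are
  nonempty, so is \<open>X\<close>.
\<close>

definition association_scheme :: "'a set \<Rightarrow> nat set \<Rightarrow> (nat \<Rightarrow> ('a \<times> 'a) set) \<Rightarrow> bool" where
  "association_scheme X D R \<longleftrightarrow>
     finite X \<and> finite D \<and> 0 \<in> D \<and>
     inj_on R D \<and> partition_on (X \<times> X) (R ` D) \<and>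
     R 0 = Id_on X \<and>
     (\<forall>i\<in>D. sym (R i)) \<and>
     (\<exists>p :: nat \<Rightarrow> nat \<Rightarrow> nat \<Rightarrow> nat. \<forall>h\<in>D. \<forall>i\<in>D. \<forall>j\<in>D. \<forall>(x, y) \<in> R h.
        card {z \<in> X. (x, z) \<in> R i \<and> (z, y) \<in> R j} = p h i j)"

definition fibres :: "'a set \<Rightarrow> (nat \<Rightarrow> ('a \<times> 'a) set) \<Rightarrow> nat set \<Rightarrow> 'a set set" where
  "fibres X R I = X // (\<Union>i\<in>I. R i)"

definition imprimitivity_system ::
    "'a set \<Rightarrow> nat set \<Rightarrow> (nat \<Rightarrow> ('a \<times> 'a) set) \<Rightarrow> nat set \<Rightarrow> bool" where
  "imprimitivity_system X D R I \<longleftrightarrow>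
     {0} \<subset> I \<and> I \<subset> D \<and>
     equiv X (\<Union>i\<in>I. R i) \<and>
     (\<exists>n. \<forall>U \<in> fibres X R I. card U = n)"

definition block_indices ::
    "nat set \<Rightarrow> (nat \<Rightarrow> ('a \<times> 'a) set) \<Rightarrow> 'a set \<Rightarrow> 'a set \<Rightarrow> nat set" where
  "block_indices D R U V = {i \<in> D. R i \<inter> (U \<times> V) \<noteq> {}}"

text \<open>
  Matrices with rows and columns indexed by \<open>X\<close> are functions of type
  \<open>'a \<Rightarrow> 'a \<Rightarrow> int\<close> that vanish outside \<open>X \<times> X\<close>.
\<close>

definition adjacency :: "('a \<times> 'a) set \<Rightarrow> 'a \<Rightarrow> 'a \<Rightarrow> int" where
  "adjacency r = (\<lambda>x y. if (x, y) \<in> r then 1 else 0)"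

definition block :: "('a \<Rightarrow> 'a \<Rightarrow> int) \<Rightarrow> 'a set \<Rightarrow> 'a set \<Rightarrow> 'a \<Rightarrow> 'a \<Rightarrow> int" where
  "block M U V = (\<lambda>x y. if x \<in> U \<and> y \<in> V then M x y else 0)"

definition matrix_product ::
    "'a set \<Rightarrow> ('a \<Rightarrow> 'a \<Rightarrow> int) \<Rightarrow> ('a \<Rightarrow> 'a \<Rightarrow> int) \<Rightarrow> 'a \<Rightarrow> 'a \<Rightarrow> int" where
  "matrix_product X M N = (\<lambda>x y. \<Sum>z\<in>X. M x z * N z y)"

definition uniform_scheme ::
    "'a set \<Rightarrow> nat set \<Rightarrow> (nat \<Rightarrow> ('a \<times> 'a) set) \<Rightarrow> nat set \<Rightarrow> bool" where
  "uniform_scheme X D R I \<longleftrightarrow>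
     association_scheme X D R \<and> imprimitivity_system X D R I \<and>
     (\<forall>U \<in> fibres X R I. \<forall>V \<in> fibres X R I. U \<noteq> V \<longrightarrow> block_indices D R U V = D - I) \<and>
     (\<exists>a :: nat \<Rightarrow> nat \<Rightarrow> nat \<Rightarrow> int.
        \<forall>U \<in> fibres X R I. \<forall>V \<in> fibres X R I. \<forall>W \<in> fibres X R I.
        \<forall>i \<in> block_indices D R U V. \<forall>j \<in> block_indices D R V W.
          matrix_product X (block (adjacency (R i)) U V) (block (adjacency (R j)) V W)
            = (\<lambda>x y. \<Sum>h\<in>D. a h i j * block (adjacency (R h)) U W x y))"

definition restricted_relations ::
    "'a set \<Rightarrow> (nat \<Rightarrow> ('a \<times> 'a) set) \<Rightarrow> nat \<Rightarrow> ('a \<times> 'a) set" where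
  "restricted_relations Y R = (\<lambda>i. R i \<inter> (Y \<times> Y))"

definition dismantlable ::
    "'a set \<Rightarrow> nat set \<Rightarrow> (nat \<Rightarrow> ('a \<times> 'a) set) \<Rightarrow> nat set \<Rightarrow> bool" where
  "dismantlable X D R I \<longleftrightarrow>
     association_scheme X D R \<and> imprimitivity_system X D R I \<and>
     (\<forall>F. F \<subseteq> fibres X R I \<and> F \<noteq> {} \<longrightarrow>
        association_scheme (\<Union>F) (block_indices D R (\<Union>F) (\<Union>F)) (restricted_relations (\<Union>F) R))"

text \<open>
  \<open>dismantled_scheme X D R I Y D' R' I'\<close>: the data \<open>Y, D', R'\<close> with the induced system \<open>I'\<close>
  come from restricting to a union \<open>Y\<close> of at least two fibres.
\<close>

definition dismantled_scheme ::
    "'a set \<Rightarrow> nat set \<Rightarrow> (nat \<Rightarrow> ('a \<times> 'a) set) \<Rightarrow> nat set \<Rightarrow>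
     'a set \<Rightarrow> nat set \<Rightarrow> (nat \<Rightarrow> ('a \<times> 'a) set) \<Rightarrow> nat set \<Rightarrow> bool" where
  "dismantled_scheme X D R I Y D' R' I' \<longleftrightarrow>
     (\<exists>F. F \<subseteq> fibres X R I \<and> card F \<ge> 2 \<and> Y = \<Union>F) \<and>
     D' = block_indices D R Y Y \<and>
     R' = restricted_relations Y R \<and>
     I' = I \<inter> D'"

end

theory Submission
  imports Defs
begin

text \<open>
  Let \<open>Y\<close> be the union of a set \<open>F\<close> of fibres and let \<open>(x, y) \<in> R h\<close> with \<open>x\<close>, \<open>y\<close> in the
  fibres \<open>U\<close>, \<open>W\<close> of \<open>F\<close>. If \<open>i\<close> or \<open>j\<close> lies in \<open>I\<close>, every \<open>z\<close> with \<open>(x, z) \<in> R i\<close> and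
  \<open>(z, y) \<in> R j\<close> lies in \<open>U \<union> W \<subseteq> Y\<close>, so the count on \<open>Y\<close> is the intersection number of the
  whole scheme. Otherwise \<open>z\<close> lies in a fibre different from \<open>U\<close> and \<open>W\<close>, and by uniformity
  each such fibre contributes \<open>a h i j\<close>; their number is \<open>|F| - 1\<close> or \<open>|F| - 2\<close> according to
  whether \<open>U = W\<close>, that is, whether \<open>h \<in> I\<close>. If \<open>F\<close> has at least two elements, no relation
  becomes empty on \<open>Y\<close>, and the structure constants \<open>a\<close> serve for \<open>Y\<close> as well.
\<close>

section \<open>Elementary consequences of the scheme axioms\<close>

lemma association_schemeD:
  assumes "association_scheme X D R"
  shows "finite X" "finite D" "0 \<in> D" "R 0 = Id_on X" "i \<in> D \<Longrightarrow> sym (R i)"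
    "i \<in> D \<Longrightarrow> R i \<subseteq> X \<times> X" "i \<in> D \<Longrightarrow> R i \<noteq> {}"
    "x \<in> X \<Longrightarrow> y \<in> X \<Longrightarrow> \<exists>i\<in>D. (x, y) \<in> R i"
    "\<lbrakk>i \<in> D; j \<in> D; (x, y) \<in> R i; (x, y) \<in> R j\<rbrakk> \<Longrightarrow> i = j"
proof -
  have inj: "inj_on R D" and part: "partition_on (X \<times> X) (R ` D)"
    using assms by (auto simp: association_scheme_def)
  show "finite X" "finite D" "0 \<in> D" "R 0 = Id_on X" "i \<in> D \<Longrightarrow> sym (R i)"
    using assms by (auto simp: association_scheme_def)
  show "i \<in> D \<Longrightarrow> R i \<subseteq> X \<times> X"
    using partition_onD1[OF part] by blast
  show "i \<in> D \<Longrightarrow> R i \<noteq> {}"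
    using partition_onD3[OF part] by (metis imageI)
  show "x \<in> X \<Longrightarrow> y \<in> X \<Longrightarrow> \<exists>i\<in>D. (x, y) \<in> R i"
    using partition_onD1[OF part] by blast
  show "i = j" if "i \<in> D" "j \<in> D" "(x, y) \<in> R i" "(x, y) \<in> R j"
  proof -
    have "R i = R j"
      using disjointD[OF partition_onD2[OF part], of "R i" "R j"] that by blast
    then show ?thesis
      using inj that by (meson inj_onD)
  qed
qed

text \<open>The valency of \<open>R i\<close> is the intersection number \<open>p 0 i i\<close>,
  hence the same at every point. It is positive at an endpoint of some pair of the nonempty relation
  \<open>R i\<close>, so it is positive everywhere.\<close>

lemma association_scheme_neighbour:
  assumes scheme: "association_scheme X D R" and i: "i \<in> D" and x: "x \<in> X"
  obtains y where "(x, y) \<in> R i"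
proof -
  note S = association_schemeD[OF scheme]
  obtain p :: "nat \<Rightarrow> nat \<Rightarrow> nat \<Rightarrow> nat" where
    p: "\<forall>h\<in>D. \<forall>i\<in>D. \<forall>j\<in>D. \<forall>(x, y) \<in> R h.
      card {z \<in> X. (x, z) \<in> R i \<and> (z, y) \<in> R j} = p h i j"
    using scheme unfolding association_scheme_def by blast
  obtain u v where uv: "(u, v) \<in> R i"
    using S(7)[OF i] by auto
  then have uX: "u \<in> X" and vX: "v \<in> X"
    using S(6)[OF i] by auto
  have "(v, u) \<in> R i"
    using S(5)[OF i] uv by (meson symD)
  then have "{z \<in> X. (u, z) \<in> R i \<and> (z, u) \<in> R i} \<noteq> {}"
    using uv vX by blast
  \<comment> \<open>The pairs \<open>(u, u)\<close> and \<open>(x, x)\<close> both lie in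
    \<open>R 0\<close>, so both counts equal \<open>p 0 i i\<close>.\<close>
  moreover have "card {z \<in> X. (u, z) \<in> R i \<and> (z, u) \<in> R i} =
      card {z \<in> X. (x, z) \<in> R i \<and> (z, x) \<in> R i}"
    using p[rule_format, OF S(3) i i, of "(u, u)"] p[rule_format, OF S(3) i i, of "(x, x)"]
    by (simp add: S(4) uX x Id_onI)
  ultimately have "{z \<in> X. (x, z) \<in> R i \<and> (z, x) \<in> R i} \<noteq> {}"
    using S(1) by (metis (no_types, lifting) card_eq_0_iff finite_subset mem_Collect_eq subsetI)
  then show thesis
    using that by blast
qed

section \<open>Fibres of an imprimitivity system and their behaviour under restriction\<close>

locale scheme_with_fibres =
  fixes X :: "'a set" and D :: "nat set" and R :: "nat \<Rightarrow> ('a \<times> 'a) set" and I :: "nat set"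
  assumes scheme: "association_scheme X D R"
    and imprim: "imprimitivity_system X D R I"
begin

lemmas schemeD = association_schemeD[OF scheme]

lemma I_subset: "I \<subseteq> D" and zero_in_I: "0 \<in> I" and equiv_fibres: "equiv X (\<Union>i\<in>I. R i)"
  using imprim by (auto simp: imprimitivity_system_def)

lemma fibre_subset: "U \<in> fibres X R I \<Longrightarrow> U \<subseteq> X"
  unfolding fibres_def by (rule in_quotient_imp_subset[OF equiv_fibres])

lemma fibre_nonempty: "U \<in> fibres X R I \<Longrightarrow> U \<noteq> {}"
  unfolding fibres_def by (rule in_quotient_imp_non_empty[OF equiv_fibres])

lemma fibre_disjoint:
  "\<lbrakk>U \<in> fibres X R I; V \<in> fibres X R I; x \<in> U; x \<in> V\<rbrakk> \<Longrightarrow> U = V"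
  unfolding fibres_def using quotient_disj[OF equiv_fibres, of U V] by blast

lemma fibre_eq_class:
  assumes "U \<in> fibres X R I" "x \<in> U"
  shows "(\<Union>i\<in>I. R i) `` {x} = U"
proof -
  have "x \<in> X"
    using assms fibre_subset by blast
  then have "(\<Union>i\<in>I. R i) `` {x} \<in> fibres X R I" "x \<in> (\<Union>i\<in>I. R i) `` {x}"
    unfolding fibres_def using equiv_class_self[OF equiv_fibres] by (auto intro: quotientI)
  then show ?thesis
    using fibre_disjoint assms by blast
qed

lemma finite_fibres: "finite (fibres X R I)"
proof (rule finite_subset)
  show "fibres X R I \<subseteq> Pow X"
    using fibre_subset by blast
  show "finite (Pow X)"
    using schemeD(1) by simp
qed

lemma fibre_closed:
  "\<lbrakk>U \<in> fibres X R I; x \<in> U; i \<in> I; (x, z) \<in> R i\<rbrakk> \<Longrightarrow> z \<in> U"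
  unfolding fibres_def using in_quotient_imp_closed[OF equiv_fibres, of U x z] by blast

text \<open>Relations with distinct labels are disjoint, so the label of a pair alone decides
  whether its points share a fibre. This lets counts that distinguish \<open>U = W\<close> from
  \<open>U \<noteq> W\<close> depend on \<open>h\<close> only.\<close>

lemma fibre_eq_iff:
  assumes "U \<in> fibres X R I" "V \<in> fibres X R I" "x \<in> U" "y \<in> V" "h \<in> D" "(x, y) \<in> R h"
  shows "U = V \<longleftrightarrow> h \<in> I"
proof -
  have "U = V \<longleftrightarrow> (x, y) \<in> (\<Union>i\<in>I. R i)"
    using assms unfolding fibres_def by (intro quotient_eq_iff[OF equiv_fibres])
  also have "\<dots> \<longleftrightarrow> h \<in> I"
    using schemeD(9) assms(5,6) I_subset by blast
  finally show ?thesis .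
qed

text \<open>Every point has an \<open>i\<close>-neighbour, and for \<open>i\<close> in
  \<open>I\<close> that neighbour stays in the same fibre. Thus a single fibre already realises all
  labels of \<open>I\<close>.\<close>

lemma I_subset_block_indices:
  assumes "F \<subseteq> fibres X R I" "F \<noteq> {}"
  shows "I \<subseteq> block_indices D R (\<Union>F) (\<Union>F)"
proof
  fix i assume i: "i \<in> I"
  obtain U x where U: "U \<in> F" "x \<in> U"
    using assms fibre_nonempty by blast
  then have "x \<in> X" "i \<in> D"
    using assms fibre_subset i I_subset by blast+
  then obtain y where y: "(x, y) \<in> R i"
    using association_scheme_neighbour[OF scheme] by metis
  then have "y \<in> U"
    using fibre_closed U i assms by blast
  then show "i \<in> block_indices D R (\<Union>F) (\<Union>F)"
    using U y \<open>i \<in> D\<close> unfolding block_indices_def by blast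
qed

text \<open>A fibre in \<open>F\<close> lies inside \<open>\<Union>F\<close>, so cutting the
  relations down to \<open>\<Union>F\<close> leaves the class of each of its points
  unchanged.\<close>

lemma fibres_restricted:
  assumes F: "F \<subseteq> fibres X R I"
  shows "fibres (\<Union>F) (restricted_relations (\<Union>F) R) I = F"
proof -
  let ?E = "\<Union>i\<in>I. R i" and ?E' = "\<Union>i\<in>I. restricted_relations (\<Union>F) R i"
  have image: "?E' `` {x} = U" if "U \<in> F" "x \<in> U" for U x
  proof -
    have U: "U \<in> fibres X R I"
      using that F by blast
    have "?E `` {x} = U"
      using U that(2) fibre_eq_class by blast
    then show ?thesis
      using that unfolding restricted_relations_def by blast
  qed
  show ?thesis
  proof
    show "fibres (\<Union>F) (restricted_relations (\<Union>F) R) I \<subseteq> F"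
    proof
      fix V assume "V \<in> fibres (\<Union>F) (restricted_relations (\<Union>F) R) I"
      then obtain x where "x \<in> \<Union>F" and V: "V = ?E' `` {x}"
        unfolding fibres_def by (rule quotientE)
      then obtain U where "U \<in> F" "x \<in> U"
        by blast
      then show "V \<in> F"
        using image V by simp
    qed
    show "F \<subseteq> fibres (\<Union>F) (restricted_relations (\<Union>F) R) I"
    proof
      fix U assume U: "U \<in> F"
      then obtain x where x: "x \<in> U"
        using F fibre_nonempty by blast
      then show "U \<in> fibres (\<Union>F) (restricted_relations (\<Union>F) R) I"
        unfolding fibres_def using image[OF U x] U by (metis UnionI quotientI)
    qed
  qed
qed

end

section \<open>Counting in uniform schemes and restriction to unions of fibres\<close>

locale uniform_fibres = scheme_with_fibres +
  fixes a :: "nat \<Rightarrow> nat \<Rightarrow> nat \<Rightarrow> int"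
  assumes block_indices_distinct:
      "\<lbrakk>U \<in> fibres X R I; V \<in> fibres X R I; U \<noteq> V\<rbrakk> \<Longrightarrow> block_indices D R U V = D - I"
    and block_product:
      "\<lbrakk>U \<in> fibres X R I; V \<in> fibres X R I; W \<in> fibres X R I;
        i \<in> block_indices D R U V; j \<in> block_indices D R V W\<rbrakk> \<Longrightarrow>
       matrix_product X (block (adjacency (R i)) U V) (block (adjacency (R j)) V W)
         = (\<lambda>x y. \<Sum>h\<in>D. a h i j * block (adjacency (R h)) U W x y)"
begin

text \<open>This is the \<open>(x, y)\<close> entry of the matrix identity in combinatorial form.
  The point is that the count does not depend on the middle fibre \<open>V\<close>; the three fibres
  need not be distinct.\<close>

lemma block_count:
  assumes fib: "U \<in> fibres X R I" "V \<in> fibres X R I" "W \<in> fibres X R I"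
    and ij: "i \<in> block_indices D R U V" "j \<in> block_indices D R V W"
    and xy: "x \<in> U" "y \<in> W" "h \<in> D" "(x, y) \<in> R h"
  shows "int (card {z \<in> V. (x, z) \<in> R i \<and> (z, y) \<in> R j}) = a h i j"
proof -
  let ?Z = "{z \<in> V. (x, z) \<in> R i \<and> (z, y) \<in> R j}"
  have "matrix_product X (block (adjacency (R i)) U V) (block (adjacency (R j)) V W) x y
      = (\<Sum>z\<in>X. if z \<in> ?Z then 1 else 0)"
    unfolding matrix_product_def using xy
    by (intro sum.cong) (auto simp: block_def adjacency_def)
  also have "\<dots> = int (card (X \<inter> ?Z))"
    using schemeD(1) by (simp add: sum.If_cases Int_def)
  also have "X \<inter> ?Z = ?Z"
    using fibre_subset[OF fib(2)] by blast
  finally have "int (card ?Z) = (\<Sum>h'\<in>D. a h' i j * block (adjacency (R h')) U W x y)"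
    using block_product[OF fib ij] by (simp add: fun_eq_iff)
  \<comment> \<open>The pair \<open>(x, y)\<close> lies in \<open>R h\<close> and in no other
    relation, so one term survives.\<close>
  also have "\<dots> = (\<Sum>h'\<in>D. if h' = h then a h i j else 0)"
    using xy schemeD(9) by (intro sum.cong) (auto simp: block_def adjacency_def)
  also have "\<dots> = a h i j"
    using xy schemeD(2) by simp
  finally show ?thesis .
qed

lemma intersection_number_across_fibres:
  assumes F: "F \<subseteq> fibres X R I"
    and ij: "i \<in> D - I" "j \<in> D - I"
    and UW: "U \<in> F" "W \<in> F" and xy: "x \<in> U" "y \<in> W" "h \<in> D" "(x, y) \<in> R h"
  shows "int (card {z \<in> \<Union>F. (x, z) \<in> R i \<and> (z, y) \<in> R j})
    = int (card F - (if h \<in> I then 1 else 2)) * a h i j"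
proof -
  let ?Z = "\<lambda>V. {z \<in> V. (x, z) \<in> R i \<and> (z, y) \<in> R j}"
  have finF: "finite F"
    using F finite_fibres finite_subset by blast
  have fib: "V \<in> fibres X R I" if "V \<in> F" for V
    using that F by blast
  have finV: "finite V" if "V \<in> F" for V
    using fibre_subset[OF fib[OF that]] schemeD(1) finite_subset by blast
  \<comment> \<open>A point \<open>z\<close> in \<open>U\<close> would force
    \<open>i \<in> I\<close>, and a point \<open>z\<close> in \<open>W\<close> would force
    \<open>j \<in> I\<close>.\<close>
  have "V \<noteq> U \<and> V \<noteq> W" if "V \<in> F" "z \<in> ?Z V" for V z
    using that fibre_eq_iff[of U V x z i] fibre_eq_iff[of V W z y j] fib UW xy ij by auto
  then have "{z \<in> \<Union>F. (x, z) \<in> R i \<and> (z, y) \<in> R j} = (\<Union>V\<in>F - {U, W}. ?Z V)"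
    by blast
  also have "card \<dots> = (\<Sum>V\<in>F - {U, W}. card (?Z V))"
  proof (rule card_UN_disjoint)
    show "finite (F - {U, W})"
      using finF by blast
    show "\<forall>V\<in>F - {U, W}. finite (?Z V)"
      using finV by simp
    show "\<forall>V\<in>F - {U, W}. \<forall>V'\<in>F - {U, W}. V \<noteq> V' \<longrightarrow> ?Z V \<inter> ?Z V' = {}"
      using fibre_disjoint fib by blast
  qed
  finally have "int (card {z \<in> \<Union>F. (x, z) \<in> R i \<and> (z, y) \<in> R j})
      = (\<Sum>V\<in>F - {U, W}. int (card (?Z V)))"
    by simp
  \<comment> \<open>As \<open>V\<close> differs from both \<open>U\<close> and \<open>W\<close>, the
    two index sets are \<open>D - I\<close> and contain \<open>i\<close> and
    \<open>j\<close>.\<close>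
  also have "\<dots> = (\<Sum>V\<in>F - {U, W}. a h i j)"
    using fib UW xy ij block_indices_distinct by (intro sum.cong block_count) auto
  finally have count: "int (card {z \<in> \<Union>F. (x, z) \<in> R i \<and> (z, y) \<in> R j})
      = int (card (F - {U, W})) * a h i j"
    by simp
  \<comment> \<open>The subtraction of naturals does not truncate: \<open>U\<close> and
    \<open>W\<close> belong to \<open>F\<close>, and they are distinct when
    \<open>h \<notin> I\<close>.\<close>
  have "card (F - {U, W}) = card F - (if h \<in> I then 1 else 2)"
    using fibre_eq_iff[of U W x y h] fib UW xy finF by (auto simp: card_Diff_subset)
  with count show ?thesis
    by (simp only:)
qed

text \<open>Restriction preserves the partition and symmetry once empty relations are dropped, and
  the label \<open>0\<close> survives because it lies in \<open>I\<close>. The real content is the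
  constancy of the intersection numbers. A single fibre is allowed here.\<close>

lemma association_scheme_union_fibres:
  assumes F: "F \<subseteq> fibres X R I" and ne: "F \<noteq> {}"
  shows "association_scheme (\<Union>F) (block_indices D R (\<Union>F) (\<Union>F)) (restricted_relations (\<Union>F) R)"
proof -
  let ?Y = "\<Union>F" and ?D = "block_indices D R (\<Union>F) (\<Union>F)" and ?R = "restricted_relations (\<Union>F) R"
  have YX: "?Y \<subseteq> X"
    using F fibre_subset by blast
  have D'D: "?D \<subseteq> D"
    by (auto simp: block_indices_def)
  have R'R: "(x, y) \<in> ?R i \<longleftrightarrow> (x, y) \<in> R i \<and> x \<in> ?Y \<and> y \<in> ?Y" for x y i
    unfolding restricted_relations_def by blast
  have nonempty: "?R i \<noteq> {}" if "i \<in> ?D" for i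
    using that unfolding block_indices_def restricted_relations_def by blast
  have disj: "i = j" if "i \<in> ?D" "j \<in> ?D" "(x, y) \<in> ?R i" "(x, y) \<in> ?R j" for i j x y
    using that schemeD(9) D'D R'R by blast
  have "finite ?Y" "finite ?D"
    using YX D'D schemeD(1,2) finite_subset by blast+
  moreover have "0 \<in> ?D"
    using I_subset_block_indices[OF F ne] zero_in_I by blast
  moreover have "inj_on ?R ?D"
  proof (rule inj_onI)
    fix i j assume ij: "i \<in> ?D" "j \<in> ?D" "?R i = ?R j"
    obtain x y where "(x, y) \<in> ?R i"
      using nonempty[OF ij(1)] by auto
    then show "i = j"
      using disj ij by metis
  qed
  moreover have "partition_on (?Y \<times> ?Y) (?R ` ?D)"
  proof (rule partition_onI)
    show "\<Union> (?R ` ?D) = ?Y \<times> ?Y"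
    proof
      show "\<Union> (?R ` ?D) \<subseteq> ?Y \<times> ?Y"
        unfolding restricted_relations_def by blast
      show "?Y \<times> ?Y \<subseteq> \<Union> (?R ` ?D)"
      proof clarify
        fix x y U V assume "x \<in> U" "U \<in> F" "y \<in> V" "V \<in> F"
        then have xy: "x \<in> ?Y" "y \<in> ?Y"
          by blast+
        then obtain i where "i \<in> D" "(x, y) \<in> R i"
          using schemeD(8) YX by blast
        then have "i \<in> ?D" "(x, y) \<in> ?R i"
          using xy R'R unfolding block_indices_def by blast+
        then show "(x, y) \<in> \<Union> (?R ` ?D)"
          by blast
      qed
    qed
    show "disjnt p q" if "p \<in> ?R ` ?D" "q \<in> ?R ` ?D" "p \<noteq> q" for p q
    proof -
      have "(x, y) \<notin> p \<inter> q" for x y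
        using that disj by blast
      then show ?thesis
        unfolding disjnt_def by auto
    qed
    show "{} \<notin> ?R ` ?D"
      using nonempty by fastforce
  qed
  moreover have "?R 0 = Id_on ?Y"
    using schemeD(4) YX unfolding restricted_relations_def by auto
  moreover have "\<forall>i\<in>?D. sym (?R i)"
    using schemeD(5) D'D R'R by (meson subsetD symD symI)
  moreover have "\<exists>p :: nat \<Rightarrow> nat \<Rightarrow> nat \<Rightarrow> nat. \<forall>h\<in>?D. \<forall>i\<in>?D. \<forall>j\<in>?D. \<forall>(x, y) \<in> ?R h.
        card {z \<in> ?Y. (x, z) \<in> ?R i \<and> (z, y) \<in> ?R j} = p h i j"
  proof -
    obtain p :: "nat \<Rightarrow> nat \<Rightarrow> nat \<Rightarrow> nat" where
      p: "\<forall>h\<in>D. \<forall>i\<in>D. \<forall>j\<in>D. \<forall>(x, y) \<in> R h.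
        card {z \<in> X. (x, z) \<in> R i \<and> (z, y) \<in> R j} = p h i j"
      using scheme unfolding association_scheme_def by blast
    \<comment> \<open>In the second branch, for labels that occur on \<open>\<Union>F\<close>, the
      integer is a cardinality, so \<open>nat\<close> loses nothing.\<close>
    define q where "q h i j = (if i \<in> I \<or> j \<in> I then p h i j
      else nat (int (card F - (if h \<in> I then 1 else 2)) * a h i j))" for h i j
    have "card {z \<in> ?Y. (x, z) \<in> ?R i \<and> (z, y) \<in> ?R j} = q h i j"
      if hij: "h \<in> ?D" "i \<in> ?D" "j \<in> ?D" and xy: "(x, y) \<in> ?R h" for h i j x y
    proof -
      have D: "h \<in> D" "i \<in> D" "j \<in> D"
        using hij D'D by blast+
      have xyR: "(x, y) \<in> R h"
        using xy R'R by blast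
      obtain U W where UW: "U \<in> F" "W \<in> F" "x \<in> U" "y \<in> W"
        using xy R'R by blast
      have "{z \<in> ?Y. (x, z) \<in> ?R i \<and> (z, y) \<in> ?R j} = {z \<in> ?Y. (x, z) \<in> R i \<and> (z, y) \<in> R j}"
        using xy R'R by blast
      also have "card \<dots> = q h i j"
      proof (cases "i \<in> I \<or> j \<in> I")
        case True
        \<comment> \<open>Either \<open>z\<close> is reached from \<open>x\<close> inside
          \<open>U\<close>, or, by symmetry of \<open>R j\<close>, from \<open>y\<close> inside
          \<open>W\<close>.\<close>
        have "z \<in> ?Y" if z: "(x, z) \<in> R i" "(z, y) \<in> R j" for z
        proof (cases "i \<in> I")
          case True
          then show ?thesis
            using fibre_closed z(1) UW F by blast
        next
          case False
          then have "j \<in> I"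
            using \<open>i \<in> I \<or> j \<in> I\<close> by blast
          moreover have "(y, z) \<in> R j"
            using z(2) schemeD(5)[OF D(3)] by (meson symD)
          ultimately show ?thesis
            using fibre_closed UW F by blast
        qed
        then have "{z \<in> ?Y. (x, z) \<in> R i \<and> (z, y) \<in> R j} = {z \<in> X. (x, z) \<in> R i \<and> (z, y) \<in> R j}"
          using YX by blast
        then show ?thesis
          using p[rule_format, OF D xyR] True by (simp add: q_def)
      next
        case False
        then have "i \<in> D - I" "j \<in> D - I"
          using D by blast+
        from intersection_number_across_fibres[OF F this UW D(1) xyR, symmetric] False show ?thesis
          by (simp only: q_def if_False nat_int)
      qed
      finally show ?thesis .
    qed
    then show ?thesis
      by (intro exI[of _ q]) auto
  qed
  ultimately show ?thesis
    unfolding association_scheme_def by (intro conjI)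
qed

text \<open>By uniformity two distinct fibres realise every label in \<open>D - I\<close>; the
  labels in \<open>I\<close> occur inside any fibre.\<close>

lemma block_indices_union_fibres:
  assumes F: "F \<subseteq> fibres X R I" and "card F \<ge> 2"
  shows "block_indices D R (\<Union>F) (\<Union>F) = D"
proof
  show "block_indices D R (\<Union>F) (\<Union>F) \<subseteq> D"
    by (auto simp: block_indices_def)
  obtain U V where UV: "U \<in> F" "V \<in> F" "U \<noteq> V"
    using assms(2) by (metis card_le_Suc0_iff_eq card.infinite not_less_eq_eq numeral_2_eq_2 zero_le)
  then have "D - I = block_indices D R U V"
    using block_indices_distinct F by blast
  also have "\<dots> \<subseteq> block_indices D R (\<Union>F) (\<Union>F)"
    using UV unfolding block_indices_def by blast
  finally show "D \<subseteq> block_indices D R (\<Union>F) (\<Union>F)"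
    using I_subset_block_indices[OF F] UV by blast
qed

text \<open>The fibres of the restriction are the members of \<open>F\<close>, and the blocks
  between them are those of the whole scheme. Both uniformity conditions are therefore inherited,
  with the same constants \<open>a\<close>.\<close>

lemma uniform_scheme_union_fibres:
  assumes F: "F \<subseteq> fibres X R I" and card_F: "card F \<ge> 2"
  shows "uniform_scheme (\<Union>F) D (restricted_relations (\<Union>F) R) I"
proof -
  let ?Y = "\<Union>F" and ?R = "restricted_relations (\<Union>F) R"
  have ne: "F \<noteq> {}"
    using card_F by auto
  have YX: "?Y \<subseteq> X"
    using F fibre_subset by blast
  have fib: "fibres ?Y ?R I = F"
    by (rule fibres_restricted[OF F])
  have "association_scheme ?Y D ?R"
    using association_scheme_union_fibres[OF F ne] block_indices_union_fibres[OF F card_F] by simp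
  moreover have "imprimitivity_system ?Y D ?R I"
  proof -
    have E: "(\<Union>i\<in>I. ?R i) = (\<Union>i\<in>I. R i) \<inter> ?Y \<times> ?Y"
      unfolding restricted_relations_def by blast
    have "equiv ?Y (\<Union>i\<in>I. ?R i)"
    proof (rule equivI)
      show "(\<Union>i\<in>I. ?R i) \<subseteq> ?Y \<times> ?Y"
        unfolding E by blast
      show "refl_on ?Y (\<Union>i\<in>I. ?R i)"
        using equiv_fibres YX unfolding E equiv_def refl_on_def by blast
      show "sym (\<Union>i\<in>I. ?R i)"
        using equiv_fibres unfolding E equiv_def sym_def by blast
      show "trans (\<Union>i\<in>I. ?R i)"
        using equiv_fibres unfolding E equiv_def trans_def by blast
    qed
    then show ?thesis
      using imprim F unfolding imprimitivity_system_def fib by blast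
  qed
  moreover have block_indices: "block_indices D ?R U V = block_indices D R U V"
    if "U \<in> F" "V \<in> F" for U V
    using that unfolding block_indices_def restricted_relations_def by blast
  then have "\<forall>U\<in>F. \<forall>V\<in>F. U \<noteq> V \<longrightarrow> block_indices D ?R U V = D - I"
    using block_indices_distinct F by (metis subsetD)
  moreover have "\<forall>U\<in>F. \<forall>V\<in>F. \<forall>W\<in>F.
      \<forall>i\<in>block_indices D ?R U V. \<forall>j\<in>block_indices D ?R V W.
      matrix_product ?Y (block (adjacency (?R i)) U V) (block (adjacency (?R j)) V W)
      = (\<lambda>x y. \<Sum>h\<in>D. a h i j * block (adjacency (?R h)) U W x y)"
  proof (intro ballI)
    fix U V W i j
    assume UVW: "U \<in> F" "V \<in> F" "W \<in> F"
      and ij: "i \<in> block_indices D ?R U V" "j \<in> block_indices D ?R V W"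
    have blk: "block (adjacency (?R k)) S T = block (adjacency (R k)) S T"
      if "S \<in> F" "T \<in> F" for k S T
      using that by (auto simp: fun_eq_iff block_def adjacency_def restricted_relations_def)
    \<comment> \<open>The terms for \<open>z\<close> in \<open>X - ?Y\<close> vanish, because the
      first block is supported on columns in \<open>V \<subseteq> ?Y\<close>.\<close>
    have "matrix_product ?Y (block (adjacency (R i)) U V) (block (adjacency (R j)) V W)
        = matrix_product X (block (adjacency (R i)) U V) (block (adjacency (R j)) V W)"
      unfolding matrix_product_def using schemeD(1) YX UVW
      by (intro ext sum.mono_neutral_left) (auto simp: block_def)
    also have "\<dots> = (\<lambda>x y. \<Sum>h\<in>D. a h i j * block (adjacency (R h)) U W x y)"
      using UVW F ij block_indices by (intro block_product) auto
    finally show "matrix_product ?Y (block (adjacency (?R i)) U V) (block (adjacency (?R j)) V W)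
        = (\<lambda>x y. \<Sum>h\<in>D. a h i j * block (adjacency (?R h)) U W x y)"
      using UVW by (simp add: blk)
  qed
  ultimately show ?thesis
    unfolding uniform_scheme_def fib by (intro conjI exI)
qed

end

section \<open>Passage from the existential definition of uniformity to the theorem\<close>

lemma uniform_scheme_imp_uniform_fibres:
  assumes "uniform_scheme X D R I"
  obtains a where "uniform_fibres X D R I a"
proof -
  obtain a :: "nat \<Rightarrow> nat \<Rightarrow> nat \<Rightarrow> int" where
    a: "\<forall>U \<in> fibres X R I. \<forall>V \<in> fibres X R I. \<forall>W \<in> fibres X R I.
        \<forall>i \<in> block_indices D R U V. \<forall>j \<in> block_indices D R V W.
          matrix_product X (block (adjacency (R i)) U V) (block (adjacency (R j)) V W)
            = (\<lambda>x y. \<Sum>h\<in>D. a h i j * block (adjacency (R h)) U W x y)"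
    using assms unfolding uniform_scheme_def by blast
  show thesis
  proof (rule that, unfold_locales)
    show "association_scheme X D R" "imprimitivity_system X D R I"
      using assms by (simp_all add: uniform_scheme_def)
    show "block_indices D R U V = D - I"
      if "U \<in> fibres X R I" "V \<in> fibres X R I" "U \<noteq> V" for U V
      using assms that by (simp add: uniform_scheme_def)
    show "matrix_product X (block (adjacency (R i)) U V) (block (adjacency (R j)) V W)
        = (\<lambda>x y. \<Sum>h\<in>D. a h i j * block (adjacency (R h)) U W x y)"
      if "U \<in> fibres X R I" "V \<in> fibres X R I" "W \<in> fibres X R I"
        "i \<in> block_indices D R U V" "j \<in> block_indices D R V W" for U V W i j
      using a[rule_format, OF that] .
  qed
qed

theorem theorem3p3:
  fixes X :: "'a set" and d :: nat and R :: "nat \<Rightarrow> ('a \<times> 'a) set" and I :: "nat set"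
  assumes "uniform_scheme X {0..d} R I"
  shows "dismantlable X {0..d} R I \<and>
    (\<forall>Y D' R' I'. dismantled_scheme X {0..d} R I Y D' R' I' \<longrightarrow> uniform_scheme Y D' R' I')"
proof -
  obtain a where "uniform_fibres X {0..d} R I a"
    using uniform_scheme_imp_uniform_fibres[OF assms] .
  then interpret uniform_fibres X "{0..d}" R I a .
  have "dismantlable X {0..d} R I"
    unfolding dismantlable_def using scheme imprim association_scheme_union_fibres by blast
  moreover have "uniform_scheme Y D' R' I'"
    if dismantled: "dismantled_scheme X {0..d} R I Y D' R' I'" for Y D' R' I'
  proof -
    obtain F where F: "F \<subseteq> fibres X R I" "card F \<ge> 2" and Y: "Y = \<Union>F"
      using dismantled unfolding dismantled_scheme_def by blast
    \<comment> \<open>With at least two fibres all labels survive, so intersecting \<open>I\<close>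
      with \<open>D'\<close> changes nothing.\<close>
    have "D' = {0..d}" "R' = restricted_relations (\<Union>F) R" "I' = I"
      using dismantled block_indices_union_fibres[OF F] I_subset
      unfolding dismantled_scheme_def Y by auto
    then show ?thesis
      using uniform_scheme_union_fibres[OF F] Y by simp
  qed
  ultimately show ?thesis
    by blast
qed

end
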